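(* Let $n\ge 2$ and let $\mathbf{A}=[a_{ij}]$ be an $n\times n$ reciprocal pairwise comparison matrix with Koczkodaj's inconsistency index $KI(\mathbf{A})$, put $\kappa=1-KI(\mathbf{A})$ and $K=\frac{1}{\kappa^2}-1$. Let $w^{EV}$ and $w^{GM}$ be the normalized priority vectors of the $n$ compared objects obtained from $\mathbf{A}$ by the eigenvalue method and by the geometric mean method, respectively, and let $O^{EV}$ and $O^{GM}$ be the corresponding ordinal rankings of all objects from the best to the worst, both assumed to be without ties. Number the objects so that $w_1^{EV}>w_2^{EV}>\dots>w_n^{EV}$ and let $d=\min_{1\le i\le n-1}(w_i^{EV}-w_{i+1}^{EV})$ be the smallest difference between adjacent eigenvalue-method weights. Let $k$ be an integer such that $0\le k\le\binom{n}{2}$, $k\cdot d<K$ and $(k+1)\cdot d>K$. Then $$\tau(O^{EV},O^{GM})\ge\frac{\binom{n}{2}-2k}{\binom{n}{2}},$$ where $\tau$ is Kendall's rank correlation coefficient.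
   Context: A pairwise comparison (PC) matrix of $n$ objects is an $n\times n$ real matrix $\mathbf{A}=[a_{ij}]$ with $a_{ij}>0$ and $a_{ii}=1$; it is reciprocal if $a_{ij}=1/a_{ji}$ for all $i,j$. All PC matrices are assumed reciprocal. Koczkodaj's inconsistency index is $$KI(\mathbf{A})=\max\left\{1-\min\left\{\frac{a_{ij}}{a_{ik}a_{kj}},\frac{a_{ik}a_{kj}}{a_{ij}}\right\} : i,j,k\in\{1,\dots,n\}\right\},$$ so $0\le KI(\mathbf{A})<1$. Eigenvalue (EV) method: $w^{EV}$ is the positive vector with $\mathbf{A}w^{EV}=\lambda_{\max}w^{EV}$, where $\lambda_{\max}$ is the largest (Perron–Frobenius) eigenvalue of $\mathbf{A}$, normalized so that $\sum_i w_i^{EV}=1$. Geometric mean (GM) method: $w_i^{GM}=\left(\prod_{k=1}^n a_{ik}\right)^{1/n}\Big/\sum_{j=1}^n\left(\prod_{k=1}^n a_{jk}\right)^{1/n}$, so $\sum_i w_i^{GM}=1$. The ordinal ranking given by a priority vector orders the objects by decreasing weight; rankings are assumed to contain no ties (they are total orders). Kendall's $\tau$: for two rankings $X=(x_i)$, $Y=(y_i)$ without ties of $n$ objects ($x_i,y_i$ being the ranks of object $i$), a pair $i<j$ is concordant if $(x_i>x_j$ and $y_i>y_j)$ or $(x_i<x_j$ and $y_i<y_j)$, and discordant otherwise. With $n_c$ concordant and $n_d$ discordant pairs, $\tau(X,Y)=\dfrac{n_c-n_d}{\binom{n}{2}}$. *)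

theory Defs
  imports "Jordan_Normal_Form.Spectral_Radius"
begin

text \<open>Objects are indexed by \<open>0, \<dots>, n - 1\<close>, following the convention for matrices.\<close>

definition pc_matrix :: "nat \<Rightarrow> real mat \<Rightarrow> bool" where
  "pc_matrix n A \<longleftrightarrow> A \<in> carrier_mat n n \<and>
     (\<forall>i<n. \<forall>j<n. A $$ (i, j) > 0) \<and> (\<forall>i<n. A $$ (i, i) = 1)"

definition reciprocal :: "real mat \<Rightarrow> bool" where
  "reciprocal A \<longleftrightarrow> (\<forall>i<dim_row A. \<forall>j<dim_row A. A $$ (i, j) = 1 / A $$ (j, i))"

definition KI :: "real mat \<Rightarrow> real" where
  "KI A = Max {1 - min (A $$ (i, j) / (A $$ (i, k) * A $$ (k, j)))
                       (A $$ (i, k) * A $$ (k, j) / A $$ (i, j)) | i j k.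
               i < dim_row A \<and> j < dim_row A \<and> k < dim_row A}"

text \<open>Here \<^const>\<open>spectrum\<close> is the finite set of real eigenvalues. For a matrix with positive
  entries its maximum is the Perron--Frobenius eigenvalue, that is, the spectral radius.\<close>

definition lambda_max :: "real mat \<Rightarrow> real" where
  "lambda_max A = Max (spectrum A)"

text \<open>By the Perron--Frobenius theorem, exactly one vector satisfies the following predicate
  when the entries of \<open>A\<close> are positive.\<close>

definition is_EV_vector :: "real mat \<Rightarrow> real vec \<Rightarrow> bool" where
  "is_EV_vector A w \<longleftrightarrow> eigenvector A w (lambda_max A) \<and>
     (\<forall>i<dim_row A. w $ i > 0) \<and> (\<Sum>i<dim_row A. w $ i) = 1"

definition GM_vector :: "real mat \<Rightarrow> real vec" where
  "GM_vector A = (let n = dim_row A; g = (\<lambda>i. root n (\<Prod>k<n. A $$ (i, k)))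
                  in vec n (\<lambda>i. g i / (\<Sum>j<n. g j)))"

definition no_ties :: "real vec \<Rightarrow> bool" where
  "no_ties w \<longleftrightarrow> inj_on (($) w) {..<dim_vec w}"

text \<open>The rank of object \<open>i\<close>; the best object, the one of largest weight, has rank 1.\<close>

definition ranking :: "real vec \<Rightarrow> nat \<Rightarrow> nat" where
  "ranking w i = Suc (card {j. j < dim_vec w \<and> w $ j > w $ i})"

definition concordant :: "(nat \<Rightarrow> nat) \<Rightarrow> (nat \<Rightarrow> nat) \<Rightarrow> nat \<Rightarrow> nat \<Rightarrow> bool" where
  "concordant x y i j \<longleftrightarrow> (x i > x j \<and> y i > y j) \<or> (x i < x j \<and> y i < y j)"

definition kendall_tau :: "nat \<Rightarrow> (nat \<Rightarrow> nat) \<Rightarrow> (nat \<Rightarrow> nat) \<Rightarrow> real" where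
  "kendall_tau n x y =
     (real (card {(i, j). i < j \<and> j < n \<and> concordant x y i j})
      - real (card {(i, j). i < j \<and> j < n \<and> \<not> concordant x y i j})) / real (n choose 2)"

end

theory Submission
  imports Defs
begin

text \<open>
  Write \<open>x\<close> for the geometric mean weights, \<open>y\<close> for the eigenvalue weights, \<open>t = 1 / \<kappa>\<^sup>2\<close>, so that
  \<open>K = t - 1\<close>, and \<open>n\<^sub>d\<close> for the number of discordant pairs. Everything reduces to \<open>n\<^sub>d d \<le> K\<close>:
  then \<open>n\<^sub>d d < (k + 1) d\<close>, hence \<open>n\<^sub>d \<le> k\<close>. The bound on \<open>n\<^sub>d d\<close> is the product of two independent
  estimates, both in terms of the distance \<open>\<Sum>\<bar>x\<^sub>i - y\<^sub>i\<bar>\<close> of the two priority vectors.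

  The first estimate says that the two methods are close. By the definition of the inconsistency
  index, \<open>a\<^sub>i\<^sub>j\<close> and \<open>a\<^sub>i\<^sub>l a\<^sub>l\<^sub>j\<close> agree up to a factor \<open>\<kappa>\<close>, so rows \<open>i\<close> and \<open>l\<close> of the matrix are
  proportional with ratio \<open>a\<^sub>i\<^sub>l\<close> up to this factor. Either priority vector is obtained by averaging
  rows, whence both \<open>x\<^sub>i / x\<^sub>l\<close> and \<open>y\<^sub>i / y\<^sub>l\<close> agree with \<open>a\<^sub>i\<^sub>l\<close> up to a factor \<open>\<kappa>\<close>, and with each
  other up to \<open>t\<close>. For two probability vectors this implies \<open>\<Sum>\<bar>x\<^sub>i - y\<^sub>i\<bar> \<le> (t - 1) / 2\<close>
  (\<open>l1_distance_le_of_ratio_bound\<close>).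

  The second estimate, \<open>n\<^sub>d d \<le> 2 \<Sum>\<bar>x\<^sub>i - y\<^sub>i\<bar>\<close> (\<open>card_inversions_le\<close>), is a statement on moving points
  on the line: if two points exchange their order, one of them moves by at least half their distance
  towards the other, and as the points are initially \<open>d\<close> apart, a point which moves by \<open>e\<close> has at
  most \<open>2 \<bar>e\<bar> / d\<close> others within distance \<open>2 \<bar>e\<bar>\<close> on the side it moves to.
\<close>

section \<open>Inversions caused by moving separated points\<close>

text \<open>Dividing by \<open>d\<close> and rounding down maps \<open>d\<close>-separated points to distinct integers.\<close>

lemma card_separated_le:
  fixes f :: "'a \<Rightarrow> real"
  assumes "d > 0" and "L \<ge> 0"
    and sep: "\<And>a b. a \<in> S \<Longrightarrow> b \<in> S \<Longrightarrow> a \<noteq> b \<Longrightarrow> d \<le> \<bar>f a - f b\<bar>"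
    and range: "\<And>a. a \<in> S \<Longrightarrow> d \<le> f a \<and> f a \<le> L"
  shows "real (card S) * d \<le> L"
proof -
  let ?g = "\<lambda>a. \<lfloor>f a / d\<rfloor>"
  have "inj_on ?g S"
  proof (rule inj_onI, rule ccontr)
    fix a b assume ab: "a \<in> S" "b \<in> S" "?g a = ?g b" "a \<noteq> b"
    have "1 \<le> \<bar>f a / d - f b / d\<bar>"
      using sep[OF ab(1,2,4)] \<open>d > 0\<close> by (simp flip: diff_divide_distrib add: le_divide_eq)
    with ab(3) show False by linarith
  qed
  moreover have "?g ` S \<subseteq> {1..\<lfloor>L / d\<rfloor>}"
  proof
    fix z assume "z \<in> ?g ` S"
    then obtain a where a: "a \<in> S" "z = ?g a" by blast
    have "1 \<le> f a / d" "f a / d \<le> L / d"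
      using range[OF a(1)] \<open>d > 0\<close> by (auto simp: divide_right_mono)
    then show "z \<in> {1..\<lfloor>L / d\<rfloor>}" using a(2) by (simp add: floor_mono)
  qed
  ultimately have "card S \<le> card {1..\<lfloor>L / d\<rfloor>}"
    by (intro card_inj_on_le) auto
  moreover have "L / d \<ge> 0" using assms by simp
  ultimately have "real (card S) \<le> of_int \<lfloor>L / d\<rfloor>"
    by (simp add: nat_le_iff le_nat_iff)
  also have "\<dots> \<le> L / d" by simp
  finally show ?thesis using \<open>d > 0\<close> by (simp add: le_divide_eq)
qed

text \<open>A pair \<open>(a, b)\<close> which is inverted between the positions \<open>p\<close> and \<open>q\<close> is charged to \<open>a\<close> if \<open>a\<close>
  moved down by at least half of \<open>p a - p b\<close>; otherwise \<open>b\<close> moved up by that much, and is charged.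
  A point is only charged for points on the side to which it moves, which is why the bound has the
  factor 2 rather than 4.\<close>

lemma card_inversions_le:
  fixes p q :: "'a \<Rightarrow> real"
  assumes "finite S" and "d > 0"
    and sep: "\<And>a b. a \<in> S \<Longrightarrow> b \<in> S \<Longrightarrow> a \<noteq> b \<Longrightarrow> d \<le> \<bar>p a - p b\<bar>"
  shows "real (card {(a, b). a \<in> S \<and> b \<in> S \<and> p b < p a \<and> q a < q b}) * d
           \<le> 2 * (\<Sum>a\<in>S. \<bar>q a - p a\<bar>)"
proof -
  define Dn where "Dn a = {b \<in> S. p b < p a \<and> p a - p b \<le> 2 * (p a - q a)}" for a
  define Up where "Up b = {a \<in> S. p b < p a \<and> p a - p b \<le> 2 * (q b - p b)}" for b
  have fin: "finite (Dn a)" "finite (Up a)" for a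
    using \<open>finite S\<close> by (auto simp: Dn_def Up_def)
  have dn: "real (card (Dn a)) * d \<le> max 0 (2 * (p a - q a))" if "a \<in> S" for a
  proof (rule card_separated_le[where f = "\<lambda>b. p a - p b"])
    show "d \<le> \<bar>(p a - p b) - (p a - p c)\<bar>" if "b \<in> Dn a" "c \<in> Dn a" "b \<noteq> c" for b c
      using sep[of b c] that by (auto simp: Dn_def)
    show "d \<le> p a - p b \<and> p a - p b \<le> max 0 (2 * (p a - q a))" if "b \<in> Dn a" for b
      using sep[of a b] that \<open>a \<in> S\<close> by (auto simp: Dn_def)
  qed (use \<open>d > 0\<close> in auto)
  have up: "real (card (Up b)) * d \<le> max 0 (2 * (q b - p b))" if "b \<in> S" for b
  proof (rule card_separated_le[where f = "\<lambda>a. p a - p b"])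
    show "d \<le> \<bar>(p a - p b) - (p c - p b)\<bar>" if "a \<in> Up b" "c \<in> Up b" "a \<noteq> c" for a c
      using sep[of a c] that by (auto simp: Up_def)
    show "d \<le> p a - p b \<and> p a - p b \<le> max 0 (2 * (q b - p b))" if "a \<in> Up b" for a
      using sep[of a b] that \<open>b \<in> S\<close> by (auto simp: Up_def)
  qed (use \<open>d > 0\<close> in auto)
  have "{(a, b). a \<in> S \<and> b \<in> S \<and> p b < p a \<and> q a < q b}
          \<subseteq> Sigma S Dn \<union> prod.swap ` Sigma S Up"
    by (auto simp: Dn_def Up_def image_iff)
  then have "card {(a, b). a \<in> S \<and> b \<in> S \<and> p b < p a \<and> q a < q b}
          \<le> card (Sigma S Dn \<union> prod.swap ` Sigma S Up)"
    using \<open>finite S\<close> fin by (intro card_mono) auto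
  also have "\<dots> \<le> card (Sigma S Dn) + card (Sigma S Up)"
    by (rule order_trans[OF card_Un_le]) (simp add: card_image)
  also have "\<dots> = (\<Sum>a\<in>S. card (Dn a) + card (Up a))"
    using \<open>finite S\<close> fin by (simp add: sum.distrib)
  finally have "real (card {(a, b). a \<in> S \<and> b \<in> S \<and> p b < p a \<and> q a < q b})
          \<le> real (\<Sum>a\<in>S. card (Dn a) + card (Up a))"
    by (rule of_nat_mono)
  then have "real (card {(a, b). a \<in> S \<and> b \<in> S \<and> p b < p a \<and> q a < q b}) * d
          \<le> real (\<Sum>a\<in>S. card (Dn a) + card (Up a)) * d"
    using \<open>d > 0\<close> by (intro mult_right_mono) auto
  also have "\<dots> = (\<Sum>a\<in>S. real (card (Dn a)) * d + real (card (Up a)) * d)"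
    by (simp add: sum_distrib_right distrib_right)
  also have "\<dots> \<le> (\<Sum>a\<in>S. 2 * \<bar>q a - p a\<bar>)"
  proof (rule sum_mono)
    fix a assume "a \<in> S"
    show "real (card (Dn a)) * d + real (card (Up a)) * d \<le> 2 * \<bar>q a - p a\<bar>"
      using dn[OF \<open>a \<in> S\<close>] up[OF \<open>a \<in> S\<close>]
      by (cases "q a < p a") (auto simp: max_def abs_if split: if_splits)
  qed
  finally show ?thesis by (simp add: sum_distrib_left)
qed

section \<open>Probability vectors with bounded ratios\<close>

text \<open>Let \<open>X\<close> and \<open>Y\<close> be the masses of the set \<open>P\<close> where \<open>x\<close> dominates \<open>y\<close>, so that the distance is
  \<open>2 (X - Y)\<close>. Summing the ratio bound over \<open>P\<close> and its complement bounds \<open>X (1 - Y)\<close> by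
  \<open>t (1 - X) Y\<close>. Hence \<open>X - Y = X (1 - Y) - (1 - X) Y \<le> (t - 1) (1 - X) Y\<close>, which is at most
  \<open>(t - 1) (1 - X) X \<le> (t - 1) / 4\<close>.\<close>

lemma l1_distance_le_of_ratio_bound:
  fixes x y :: "'a \<Rightarrow> real"
  assumes "finite S" and "t \<ge> 1"
    and nonneg: "\<And>i. i \<in> S \<Longrightarrow> 0 \<le> x i"
    and sums: "(\<Sum>i\<in>S. x i) = 1" "(\<Sum>i\<in>S. y i) = 1"
    and ratio: "\<And>i j. i \<in> S \<Longrightarrow> j \<in> S \<Longrightarrow> x i * y j \<le> t * (x j * y i)"
  shows "2 * (\<Sum>i\<in>S. \<bar>x i - y i\<bar>) \<le> t - 1"
proof -
  define P where "P = {i \<in> S. y i \<le> x i}"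
  define X where "X = (\<Sum>i\<in>P. x i)"
  define Y where "Y = (\<Sum>i\<in>P. y i)"
  have P: "P \<subseteq> S" "finite P" using \<open>finite S\<close> by (auto simp: P_def)
  have split: "(\<Sum>i\<in>S. f i) = (\<Sum>i\<in>P. f i) + (\<Sum>i\<in>S-P. f i)" for f :: "'a \<Rightarrow> real"
    using sum.subset_diff[OF P(1) \<open>finite S\<close>, of f] by simp
  have X': "(\<Sum>i\<in>S-P. x i) = 1 - X" and Y': "(\<Sum>i\<in>S-P. y i) = 1 - Y"
    using split[of x] split[of y] sums by (auto simp: X_def Y_def)
  have "(\<Sum>i\<in>P. \<bar>x i - y i\<bar>) = (\<Sum>i\<in>P. x i - y i)"
    by (rule sum.cong) (auto simp: P_def)
  moreover have "(\<Sum>i\<in>S-P. \<bar>x i - y i\<bar>) = (\<Sum>i\<in>S-P. y i - x i)"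
    by (rule sum.cong) (auto simp: P_def)
  ultimately have "(\<Sum>i\<in>P. \<bar>x i - y i\<bar>) = X - Y" "(\<Sum>i\<in>S-P. \<bar>x i - y i\<bar>) = (1 - Y) - (1 - X)"
    unfolding sum_subtractf X' Y' X_def[symmetric] Y_def[symmetric] by simp_all
  then have dist: "(\<Sum>i\<in>S. \<bar>x i - y i\<bar>) = 2 * (X - Y)"
    using split[of "\<lambda>i. \<bar>x i - y i\<bar>"] by simp
  have "X * (1 - Y) = (\<Sum>i\<in>P. \<Sum>j\<in>S-P. x i * y j)"
    by (simp add: X_def Y'[symmetric] sum_product)
  also have "\<dots> \<le> (\<Sum>i\<in>P. \<Sum>j\<in>S-P. t * (y i * x j))"
    using P by (intro sum_mono) (metis DiffD1 mult.commute ratio subsetD)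
  also have "\<dots> = t * (Y * (1 - X))"
    unfolding Y_def X'[symmetric] sum_product by (simp only: sum_distrib_left)
  finally have *: "X * (1 - Y) \<le> t * (Y * (1 - X))" .
  have "Y \<le> X" unfolding X_def Y_def by (rule sum_mono) (simp add: P_def)
  moreover have "0 \<le> 1 - X" unfolding X'[symmetric] using nonneg by (intro sum_nonneg) auto
  ultimately have "Y * (1 - X) \<le> X * (1 - X)" by (rule mult_right_mono)
  also have "\<dots> \<le> 1 / 4"
    using zero_le_power2[of "X - 1 / 2"] by (simp add: power2_eq_square algebra_simps)
  finally have "(t - 1) * (Y * (1 - X)) \<le> (t - 1) * (1 / 4)"
    using \<open>t \<ge> 1\<close> by (intro mult_left_mono) auto
  with * show ?thesis unfolding dist by (simp add: algebra_simps)
qed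

section \<open>Both priority vectors almost reproduce the comparisons\<close>

text \<open>The bounds hold for all triads, including those with repeated indices: the triad \<open>(0, 0, 0)\<close>
  gives \<open>KI A \<ge> 0\<close>, and \<open>KI A < 1\<close> because the maximum is attained at some triad of positive
  entries.\<close>

lemma KI_triad_bounds:
  assumes pc: "pc_matrix n A" and "n > 0"
  shows "0 < 1 - KI A" and "1 - KI A \<le> 1"
    and "\<And>i j l. i < n \<Longrightarrow> j < n \<Longrightarrow> l < n \<Longrightarrow>
           (1 - KI A) * A $$ (i, j) \<le> A $$ (i, l) * A $$ (l, j)"
    and "\<And>i j l. i < n \<Longrightarrow> j < n \<Longrightarrow> l < n \<Longrightarrow>
           (1 - KI A) * (A $$ (i, l) * A $$ (l, j)) \<le> A $$ (i, j)"
proof -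
  define f where "f = (\<lambda>(i, j, k). 1 - min (A $$ (i, j) / (A $$ (i, k) * A $$ (k, j)))
                       (A $$ (i, k) * A $$ (k, j) / A $$ (i, j)))"
  let ?T = "{..<n} \<times> {..<n} \<times> {..<n}"
  have dim: "dim_row A = n" and pos: "\<And>i j. i < n \<Longrightarrow> j < n \<Longrightarrow> 0 < A $$ (i, j)"
    and diag: "\<And>i. i < n \<Longrightarrow> A $$ (i, i) = 1"
    using pc by (auto simp: pc_matrix_def)
  have KI: "KI A = Max (f ` ?T)"
    unfolding KI_def dim f_def by (rule arg_cong[where f = Max]) (force simp: image_iff)
  have "?T \<noteq> {}" using \<open>n > 0\<close> by auto
  then have "KI A \<in> f ` ?T" unfolding KI by (intro Max_in) auto
  then show "0 < 1 - KI A" by (auto simp: f_def pos min_def)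
  have le: "f (i, j, l) \<le> KI A" if "i < n" "j < n" "l < n" for i j l
    unfolding KI using that by (intro Max_ge) auto
  show "1 - KI A \<le> 1"
    using le[of 0 0 0] \<open>n > 0\<close> diag by (simp add: f_def)
  fix i j l assume *: "i < n" "j < n" "l < n"
  have "1 - KI A \<le> A $$ (i, j) / (A $$ (i, l) * A $$ (l, j))"
    and "1 - KI A \<le> A $$ (i, l) * A $$ (l, j) / A $$ (i, j)"
    using le[OF *] by (auto simp: f_def)
  then show "(1 - KI A) * A $$ (i, j) \<le> A $$ (i, l) * A $$ (l, j)"
    and "(1 - KI A) * (A $$ (i, l) * A $$ (l, j)) \<le> A $$ (i, j)"
    using * pos by (simp_all add: le_divide_eq)
qed

text \<open>Entry \<open>i\<close> of an eigenvector is, up to the eigenvalue, the combination of the entries of row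
  \<open>i\<close> with the positive weights \<open>y\<close>, so an entrywise comparison between two rows carries over. The
  same combination shows that the eigenvalue is positive, so that it can be cancelled.\<close>

lemma eigenvector_ratio_le:
  fixes A :: "real mat"
  assumes A: "A \<in> carrier_mat n n" and pos: "\<And>i j. i < n \<Longrightarrow> j < n \<Longrightarrow> 0 < A $$ (i, j)"
    and ev: "eigenvector A y \<mu>" and y: "\<And>i. i < n \<Longrightarrow> 0 < y $ i"
    and i: "i < n" and l: "l < n"
    and rows: "\<And>j. j < n \<Longrightarrow> c * A $$ (i, j) \<le> b * A $$ (l, j)"
  shows "c * y $ i \<le> b * y $ l"
proof -
  have dim: "dim_row A = n" "dim_col A = n" "dim_vec y = n"
    using A ev by (auto simp: eigenvector_def)
  have eq: "\<mu> * y $ m = (\<Sum>j<n. A $$ (m, j) * y $ j)" if "m < n" for m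
  proof -
    have "(A *\<^sub>v y) $ m = (\<mu> \<cdot>\<^sub>v y) $ m" using ev by (simp add: eigenvector_def)
    then show ?thesis using that dim by (simp add: scalar_prod_def atLeast0LessThan)
  qed
  have "0 < \<mu> * y $ i"
    unfolding eq[OF i] using i pos y by (intro sum_pos) auto
  then have "\<mu> > 0" using y[OF i] by (simp add: zero_less_mult_iff)
  have "\<mu> * (c * y $ i) = (\<Sum>j<n. (c * A $$ (i, j)) * y $ j)"
    unfolding mult.left_commute[of \<mu>] eq[OF i] by (simp add: sum_distrib_left mult.assoc)
  also have "\<dots> \<le> (\<Sum>j<n. (b * A $$ (l, j)) * y $ j)"
    using rows y by (intro sum_mono mult_right_mono) (auto intro: less_imp_le)
  also have "\<dots> = \<mu> * (b * y $ l)"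
    unfolding mult.left_commute[of \<mu>] eq[OF l] by (simp add: sum_distrib_left mult.assoc)
  finally show ?thesis using \<open>\<mu> > 0\<close> by simp
qed

lemma GM_vector_sum_pos:
  assumes "A \<in> carrier_mat n n" and "n > 0"
    and pos: "\<And>i j. i < n \<Longrightarrow> j < n \<Longrightarrow> 0 < A $$ (i, j)"
  shows "0 < (\<Sum>i<n. root n (\<Prod>k<n. A $$ (i, k)))"
  using assms by (intro sum_pos) (auto intro!: prod_pos)

lemma GM_vector_pos:
  assumes "A \<in> carrier_mat n n" and "n > 0"
    and pos: "\<And>i j. i < n \<Longrightarrow> j < n \<Longrightarrow> 0 < A $$ (i, j)" and "i < n"
  shows "0 < GM_vector A $ i"
  using assms GM_vector_sum_pos[OF assms(1-3)]
  by (auto simp: GM_vector_def Let_def intro!: divide_pos_pos prod_pos)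

lemma GM_vector_sum:
  assumes "A \<in> carrier_mat n n" and "n > 0"
    and pos: "\<And>i j. i < n \<Longrightarrow> j < n \<Longrightarrow> 0 < A $$ (i, j)"
  shows "(\<Sum>i<n. GM_vector A $ i) = 1"
  using assms(1) GM_vector_sum_pos[OF assms]
  by (simp add: GM_vector_def Let_def flip: sum_divide_distrib)

lemma GM_vector_ratio_le:
  fixes A :: "real mat"
  assumes A: "A \<in> carrier_mat n n" and "n > 0"
    and pos: "\<And>i j. i < n \<Longrightarrow> j < n \<Longrightarrow> 0 < A $$ (i, j)"
    and i: "i < n" and l: "l < n" and "0 \<le> c"
    and rows: "\<And>j. j < n \<Longrightarrow> c * A $$ (l, j) \<le> A $$ (i, j)"
  shows "c * GM_vector A $ l \<le> GM_vector A $ i"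
proof -
  let ?g = "\<lambda>i. root n (\<Prod>k<n. A $$ (i, k))"
  have "c * ?g l = root n (c ^ n * (\<Prod>k<n. A $$ (l, k)))"
    using \<open>n > 0\<close> \<open>0 \<le> c\<close> by (simp add: real_root_mult real_root_power_cancel)
  also have "c ^ n * (\<Prod>k<n. A $$ (l, k)) = (\<Prod>k<n. c * A $$ (l, k))"
    by (simp add: prod.distrib)
  also have "root n \<dots> \<le> ?g i"
    using \<open>n > 0\<close> \<open>0 \<le> c\<close> rows pos l
    by (intro real_root_le_mono prod_mono) (auto intro!: mult_nonneg_nonneg intro: less_imp_le)
  finally have "c * ?g l / (\<Sum>i<n. ?g i) \<le> ?g i / (\<Sum>i<n. ?g i)"
    using GM_vector_sum_pos[OF A \<open>n > 0\<close> pos] by (intro divide_right_mono) auto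
  then show ?thesis using A i l by (simp add: GM_vector_def Let_def)
qed

theorem priority_vectors_l1_distance:
  assumes pc: "pc_matrix n A" and "n > 0" and ev: "is_EV_vector A y"
  shows "2 * (\<Sum>i<n. \<bar>GM_vector A $ i - y $ i\<bar>) \<le> 1 / (1 - KI A)\<^sup>2 - 1"
proof -
  define \<kappa> where "\<kappa> = 1 - KI A"
  let ?x = "GM_vector A"
  have A: "A \<in> carrier_mat n n" and pos: "\<And>i j. i < n \<Longrightarrow> j < n \<Longrightarrow> 0 < A $$ (i, j)"
    using pc by (auto simp: pc_matrix_def)
  have y: "eigenvector A y (lambda_max A)" "\<And>i. i < n \<Longrightarrow> 0 < y $ i" "(\<Sum>i<n. y $ i) = 1"
    using ev A by (auto simp: is_EV_vector_def)
  note triad = KI_triad_bounds[OF pc \<open>n > 0\<close>, folded \<kappa>_def]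
  have x_pos: "\<And>i. i < n \<Longrightarrow> 0 < ?x $ i" by (rule GM_vector_pos[OF A \<open>n > 0\<close> pos])
  \<comment> \<open>\<open>y l / y i\<close> is at most \<open>A (l, i) / \<kappa>\<close>, and \<open>x l / x i\<close> is at least \<open>\<kappa> A (l, i)\<close>\<close>
  have "?x $ i * y $ l \<le> 1 / \<kappa>\<^sup>2 * (?x $ l * y $ i)" if i: "i < n" and l: "l < n" for i l
  proof -
    have "\<kappa> * y $ l \<le> A $$ (l, i) * y $ i"
      by (rule eigenvector_ratio_le[OF A pos y(1) y(2) l i triad(3)]) (use i l in auto)
    then have "\<kappa> * ?x $ i * (\<kappa> * y $ l) \<le> \<kappa> * ?x $ i * (A $$ (l, i) * y $ i)"
      using triad(1) x_pos[OF i] by (intro mult_left_mono) auto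
    also have "\<dots> = \<kappa> * A $$ (l, i) * ?x $ i * y $ i" by simp
    also have "\<dots> \<le> ?x $ l * y $ i"
    proof (rule mult_right_mono)
      show "\<kappa> * A $$ (l, i) * ?x $ i \<le> ?x $ l"
        by (rule GM_vector_ratio_le[OF A \<open>n > 0\<close> pos l i])
          (use triad(1) triad(4) i l pos in \<open>auto simp: mult.assoc intro: less_imp_le\<close>)
    qed (use y(2) i in \<open>auto intro: less_imp_le\<close>)
    finally show ?thesis using triad(1) by (simp add: field_simps power2_eq_square)
  qed
  moreover have "1 \<le> 1 / \<kappa>\<^sup>2" using triad(1,2) by (simp add: power_le_one)
  ultimately have "2 * (\<Sum>i<n. \<bar>?x $ i - y $ i\<bar>) \<le> 1 / \<kappa>\<^sup>2 - 1"
    using x_pos y GM_vector_sum[OF A \<open>n > 0\<close> pos]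
    by (intro l1_distance_le_of_ratio_bound) (auto intro: less_imp_le)
  then show ?thesis by (simp add: \<kappa>_def)
qed

section \<open>Kendall's coefficient and inversions\<close>

lemma ranking_less_iff:
  assumes "i < dim_vec w" and "j < dim_vec w"
  shows "ranking w i < ranking w j \<longleftrightarrow> w $ j < w $ i"
proof
  let ?B = "\<lambda>i. {m. m < dim_vec w \<and> w $ m > w $ i}"
  { assume "w $ j < w $ i"
    then have "?B i \<subset> ?B j" using assms by force
    then show "ranking w i < ranking w j"
      by (simp add: ranking_def psubset_card_mono) }
  show "w $ j < w $ i" if "ranking w i < ranking w j"
  proof (rule ccontr)
    assume "\<not> w $ j < w $ i"
    then have "?B j \<subseteq> ?B i" by auto
    then have "card (?B j) \<le> card (?B i)" by (intro card_mono) auto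
    with that show False by (simp add: ranking_def)
  qed
qed

lemma card_pairs: "card {(i, j). i < j \<and> j < (n::nat)} = n choose 2"
proof -
  have "{(i, j). i < j \<and> j < n} = prod.swap ` Sigma {..<n} (\<lambda>j. {..<j})"
    by (auto simp: image_iff)
  then have "card {(i, j). i < j \<and> j < n} = (\<Sum>j<n. j)" by (simp add: card_image)
  also have "\<dots> = n choose 2" by (induction n) (auto simp: numeral_2_eq_2)
  finally show ?thesis .
qed

lemma kendall_tau_eq:
  "kendall_tau n x y =
     (real (n choose 2) - 2 * real (card {(i, j). i < j \<and> j < n \<and> \<not> concordant x y i j}))
       / real (n choose 2)"
proof -
  let ?C = "{(i, j). i < j \<and> j < n \<and> concordant x y i j}"
  let ?D = "{(i, j). i < j \<and> j < n \<and> \<not> concordant x y i j}"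
  have fin: "finite ?C" "finite ?D"
    by (rule finite_subset[of _ "{..<n} \<times> {..<n}"]; auto)+
  have "?C \<union> ?D = {(i, j). i < j \<and> j < n}" "?C \<inter> ?D = {}" by auto
  then have "card ?C + card ?D = n choose 2"
    using card_Un_disjoint[OF fin] by (simp add: card_pairs)
  then have "real (n choose 2) = real (card ?C) + real (card ?D)" by linarith
  then show ?thesis unfolding kendall_tau_def by simp
qed

lemma card_discordant_le:
  assumes dim: "dim_vec v = n" "dim_vec w = n" and "no_ties v" and "no_ties w"
  shows "card {(i, j). i < j \<and> j < n \<and> \<not> concordant (ranking v) (ranking w) i j}
           \<le> card {(a, b). a \<in> {..<n} \<and> b \<in> {..<n} \<and> v $ b < v $ a \<and> w $ a < w $ b}"
    (is "card ?D \<le> card ?I")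
proof (rule card_inj_on_le)
  \<comment> \<open>orient each unordered pair so that the first method prefers its first component\<close>
  let ?h = "\<lambda>(i, j). if v $ j < v $ i then (i, j) else (j, i)"
  show "inj_on ?h ?D" by (auto simp: inj_on_def split: if_splits)
  show "?h ` ?D \<subseteq> ?I"
  proof clarify
    fix i j a b assume ij: "i < j" "j < n" "\<not> concordant (ranking v) (ranking w) i j"
      and h: "(a, b) = (if v $ j < v $ i then (i, j) else (j, i))"
    have "v $ i \<noteq> v $ j" "w $ i \<noteq> w $ j"
      using ij assms by (auto simp: no_ties_def inj_on_def)
    then show "a \<in> {..<n} \<and> b \<in> {..<n} \<and> v $ b < v $ a \<and> w $ a < w $ b"
      using ij h dim by (auto simp: concordant_def ranking_less_iff split: if_splits)
  qed
  show "finite ?I" by (rule finite_subset[of _ "{..<n} \<times> {..<n}"]) auto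
qed

section \<open>The bound on Kendall's coefficient\<close>

lemma separated_of_adjacent_gaps:
  fixes f :: "nat \<Rightarrow> real"
  assumes "0 \<le> d" and gap: "\<And>i. i \<in> {1..n - 1} \<Longrightarrow> d \<le> f i - f (i + 1)"
    and "1 \<le> i" and "i < j" and "j \<le> n"
  shows "d \<le> f i - f j"
  using \<open>i < j\<close> \<open>j \<le> n\<close>
proof (induction j)
  case (Suc j)
  have "d \<le> f j - f (j + 1)" using Suc.prems \<open>1 \<le> i\<close> by (intro gap) auto
  then show ?case using Suc \<open>0 \<le> d\<close> by (cases "i = j") auto
qed simp

theorem proposition3:
  fixes n :: nat and A :: "real mat" and wEV :: "real vec"
    and \<kappa> K d :: real and \<sigma> :: "nat \<Rightarrow> nat" and k :: int
  assumes "n \<ge> 2"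
    and "pc_matrix n A" and "reciprocal A"
    and "\<kappa> = 1 - KI A" and "K = 1 / \<kappa>\<^sup>2 - 1"
    and "is_EV_vector A wEV"
    and "no_ties wEV" and "no_ties (GM_vector A)"
    and "bij_betw \<sigma> {1..n} {..<n}"
    and "\<forall>i\<in>{1..n - 1}. wEV $ \<sigma> i > wEV $ \<sigma> (i + 1)"
    and "d = Min ((\<lambda>i. wEV $ \<sigma> i - wEV $ \<sigma> (i + 1)) ` {1..n - 1})"
    and "0 \<le> k" and "k \<le> int (n choose 2)"
    and "real_of_int k * d < K" and "real_of_int (k + 1) * d > K"
  shows "kendall_tau n (ranking wEV) (ranking (GM_vector A))
           \<ge> (real (n choose 2) - 2 * real_of_int k) / real (n choose 2)"
proof -
  let ?gap = "\<lambda>i. wEV $ \<sigma> i - wEV $ \<sigma> (i + 1)"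
  let ?D = "{(i, j). i < j \<and> j < n \<and> \<not> concordant (ranking wEV) (ranking (GM_vector A)) i j}"
  let ?I = "{(a, b). a \<in> {..<n} \<and> b \<in> {..<n} \<and> wEV $ b < wEV $ a
                \<and> GM_vector A $ a < GM_vector A $ b}"
  have dim: "dim_vec wEV = n" "dim_vec (GM_vector A) = n"
    using assms by (auto simp: is_EV_vector_def eigenvector_def pc_matrix_def GM_vector_def Let_def)
  have "{1..n - 1} \<noteq> {}" using \<open>n \<ge> 2\<close> by auto
  then have "d \<in> ?gap ` {1..n - 1}" unfolding assms(11) by (intro Min_in) auto
  then have "d > 0" using assms(10) by auto
  have gap: "d \<le> ?gap i" if "i \<in> {1..n - 1}" for i
    unfolding assms(11) using that by (intro Min_le) auto
  have sep: "d \<le> \<bar>wEV $ a - wEV $ b\<bar>" if "a \<in> {..<n}" "b \<in> {..<n}" "a \<noteq> b" for a b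
  proof -
    have "a \<in> \<sigma> ` {1..n}" "b \<in> \<sigma> ` {1..n}"
      using that bij_betw_imp_surj_on[OF assms(9)] by simp_all
    then obtain i j where ij: "i \<in> {1..n}" "j \<in> {1..n}" "a = \<sigma> i" "b = \<sigma> j"
      by blast
    have mono: "d \<le> wEV $ \<sigma> i - wEV $ \<sigma> j" if "i < j" "1 \<le> i" "j \<le> n" for i j
      by (rule separated_of_adjacent_gaps[of d n "\<lambda>i. wEV $ \<sigma> i"])
        (use gap that \<open>d > 0\<close> in auto)
    have "i \<noteq> j" using ij that by auto
    then consider "i < j" | "j < i" by linarith
    then show ?thesis
    proof cases
      case 1
      then show ?thesis using mono[of i j] ij by simp
    next
      case 2
      then show ?thesis using mono[of j i] ij by simp
    qed
  qed
  have "real (card ?D) \<le> real (card ?I)"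
    using card_discordant_le[OF dim assms(7,8)] by simp
  then have "real (card ?D) * d \<le> real (card ?I) * d"
    using \<open>d > 0\<close> by (intro mult_right_mono) auto
  also have "\<dots> \<le> 2 * (\<Sum>a<n. \<bar>GM_vector A $ a - wEV $ a\<bar>)"
    using \<open>d > 0\<close> sep by (intro card_inversions_le) auto
  also have "\<dots> \<le> K"
    using priority_vectors_l1_distance[OF assms(2) _ assms(6)] assms(1,4,5) by simp
  also have "\<dots> < real_of_int (k + 1) * d" by (rule assms(15))
  finally have "real (card ?D) < real_of_int (k + 1)" using \<open>d > 0\<close> by simp
  then have "real_of_int (int (card ?D)) < real_of_int (k + 1)" by simp
  then have "int (card ?D) \<le> k" unfolding of_int_less_iff by simp
  then have "real_of_int (int (card ?D)) \<le> real_of_int k" unfolding of_int_le_iff .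
  then show ?thesis unfolding kendall_tau_eq by (intro divide_right_mono) auto
qed

end
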